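(* Each of the algorithms \textsf{P}, \textsf{E}, \textsf{A}, \textsf{R}, \textsf{RA} (defined below) is correct: run on an undirected graph with vertex set $[n]$, when it stops, the parent pointers form exactly one flat tree per connected component of the input graph; that is, for every vertex $v$, $v.p$ is a vertex of the component of $v$ with $(v.p).p=v.p$, and two vertices have the same parent if and only if they lie in the same connected component.
   Context: Each edge $e$ has two ends $e.v,e.w$; the current edge set is initially the input edge set. Each vertex $v$ has a parent $v.p$, initially $v$; $v$ is a root if $v.p=v$. The algorithms keep the parent digraph acyclic apart from loops at roots, so it is a forest (the label forest) whose trees are rooted at roots; a tree is flat if every non-root vertex in it has the root as parent. Vertices are compared as integers. Each operation is performed simultaneously for all edges/vertices using values at the start of the operation. \textsc{connect}: for each edge $e$, send $\min\{e.v,e.w\}$ to $\max\{e.v,e.w\}$. \textsc{parent-connect}: for each edge $e$, let $x=e.v.p$, $y=e.w.p$; send $\min\{x,y\}$ to $\max\{x,y\}$. \textsc{extended-connect}: for each edge $e$, let $x=e.v.p$, $y=e.w.p$; if $y<x$ send $y$ to $e.v$ and to $x$, else send $x$ to $e.w$ and to $y$. \textsc{update}: for each vertex $v$, replace $v.p$ by the minimum of $v.p$ and the vertices sent to $v$ in the preceding connect operation. \textsc{root-update}: the same, but only for roots $v$. \textsc{shortcut}: for each vertex $v$, replace $v.p$ by $(v.p).p$. \textsc{alter}: for each edge $e$, let $x=e.v.p$, $y=e.w.p$; if $x=y$ delete $e$, else replace $e.v,e.w$ by $x,y$. Each algorithm repeats a round until a round in which no parent changes: \textsf{P}: \textsc{parent-connect};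 \textsc{update}; \textsc{shortcut}. \textsf{E}: \textsc{extended-connect}; \textsc{update}; \textsc{shortcut}. \textsf{A}: \textsc{connect}; \textsc{update}; \textsc{shortcut}; \textsc{alter}. \textsf{R}: \textsc{parent-connect}; \textsc{root-update}; \textsc{shortcut}. \textsf{RA}: \textsc{connect}; \textsc{root-update}; \textsc{shortcut}; \textsc{alter}. *)

theory Defs
  imports Main
begin

text \<open>
  An undirected multigraph is given by a vertex count, a set of edges and the two ends of each
  edge. Which end is called \<open>v\<close> and which \<open>w\<close> is arbitrary; loops and parallel edges are allowed
  (replacing edge ends by their parents may create parallel edges from a simple input graph).
\<close>

record 'e ugraph =
  vcount :: nat
  edges :: "'e set"
  end_v :: "'e \<Rightarrow> nat"
  end_w :: "'e \<Rightarrow> nat"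

definition vertices :: "('e, 'z) ugraph_scheme \<Rightarrow> nat set" where
  "vertices G = {1..vcount G}"

definition ugraph :: "('e, 'z) ugraph_scheme \<Rightarrow> bool" where
  "ugraph G \<longleftrightarrow> finite (edges G) \<and>
     (\<forall>e\<in>edges G. end_v G e \<in> vertices G \<and> end_w G e \<in> vertices G)"

definition adjacency :: "('e, 'z) ugraph_scheme \<Rightarrow> (nat \<times> nat) set" where
  "adjacency G =
     {(end_v G e, end_w G e) | e. e \<in> edges G} \<union> {(end_w G e, end_v G e) | e. e \<in> edges G}"

definition component :: "('e, 'z) ugraph_scheme \<Rightarrow> nat \<Rightarrow> nat set" where
  "component G v = {u \<in> vertices G. (v, u) \<in> (adjacency G)\<^sup>*}"

text \<open>A state is the current graph together with the parent pointers.\<close>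

record 'e state = "'e ugraph" +
  parent :: "nat \<Rightarrow> nat"

definition init :: "'e ugraph \<Rightarrow> 'e state" where
  "init G = \<lparr>vcount = vcount G, edges = edges G, end_v = end_v G, end_w = end_w G,
     parent = \<lambda>v. v\<rparr>"

text \<open>
  A connect operation yields the set of its messages; \<open>(a, u)\<close> means that \<open>a\<close> is sent to \<open>u\<close>.
\<close>

definition connect :: "'e state \<Rightarrow> (nat \<times> nat) set" where
  "connect s =
     {(min (end_v s e) (end_w s e), max (end_v s e) (end_w s e)) | e. e \<in> edges s}"

definition parent_connect :: "'e state \<Rightarrow> (nat \<times> nat) set" where
  "parent_connect s =
     {(min x y, max x y) | x y e.
        e \<in> edges s \<and> x = parent s (end_v s e) \<and> y = parent s (end_w s e)}"

definition extended_connect :: "'e state \<Rightarrow> (nat \<times> nat) set" where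
  "extended_connect s =
     (\<Union>e\<in>edges s.
        let x = parent s (end_v s e); y = parent s (end_w s e)
        in if y < x then {(y, end_v s e), (y, x)} else {(x, end_w s e), (x, y)})"

definition update :: "(nat \<times> nat) set \<Rightarrow> 'e state \<Rightarrow> 'e state" where
  "update M s = s\<lparr>parent := \<lambda>v. Min (insert (parent s v) {a. (a, v) \<in> M})\<rparr>"

definition root_update :: "(nat \<times> nat) set \<Rightarrow> 'e state \<Rightarrow> 'e state" where
  "root_update M s = s\<lparr>parent := \<lambda>v.
     if parent s v = v then Min (insert (parent s v) {a. (a, v) \<in> M}) else parent s v\<rparr>"

definition shortcut :: "'e state \<Rightarrow> 'e state" where
  "shortcut s = s\<lparr>parent := \<lambda>v. parent s (parent s v)\<rparr>"

definition alter :: "'e state \<Rightarrow> 'e state" where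
  "alter s = s\<lparr>
     edges := {e \<in> edges s. parent s (end_v s e) \<noteq> parent s (end_w s e)},
     end_v := \<lambda>e. parent s (end_v s e),
     end_w := \<lambda>e. parent s (end_w s e)\<rparr>"

datatype algorithm = Alg_P | Alg_E | Alg_A | Alg_R | Alg_RA

fun round :: "algorithm \<Rightarrow> 'e state \<Rightarrow> 'e state" where
  "round Alg_P s = shortcut (update (parent_connect s) s)"
| "round Alg_E s = shortcut (update (extended_connect s) s)"
| "round Alg_A s = alter (shortcut (update (connect s) s))"
| "round Alg_R s = shortcut (root_update (parent_connect s) s)"
| "round Alg_RA s = alter (shortcut (root_update (connect s) s))"

definition parent_unchanged :: "'e state \<Rightarrow> 'e state \<Rightarrow> bool" where
  "parent_unchanged s t \<longleftrightarrow> (\<forall>v\<in>vertices s. parent t v = parent s v)"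

text \<open>
  \<open>stops_in alg s t\<close>: the loop started in \<open>s\<close> stops, and it does so in state \<open>t\<close>. At least one
  round is performed, and the state after the round without a parent change is the final one.
\<close>

inductive stops_in :: "algorithm \<Rightarrow> 'e state \<Rightarrow> 'e state \<Rightarrow> bool" for alg where
  last: "parent_unchanged s (round alg s) \<Longrightarrow> stops_in alg s (round alg s)"
| again: "\<not> parent_unchanged s (round alg s) \<Longrightarrow> stops_in alg (round alg s) t
    \<Longrightarrow> stops_in alg s t"

end

theory Submission
  imports Defs
begin

text \<open>
  Parents never leave their component and never increase, so the sum of all parents is a
  termination measure, and a round that changes no parent starts from flat trees in which no root
  receives a smaller vertex. If the edges are never altered, the parents of the ends of an edge
  are then roots, so they coincide.

  With \<open>alter\<close>, an update may cut a non-root from its old parent. Connectivity is not lost because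
  every end of a current edge is connected to its parent by current edges, a property that is
  preserved since \<open>alter\<close> maps paths to paths. Moreover every end of a current edge is a parent,
  hence a root when the loop stops, so no edges are left then.
\<close>

section \<open>Connect and update operations\<close>

text \<open>A nondeterministic specification covering \<open>update\<close> and
  \<open>root_update\<close> at once. Minimality among the received vertices is demanded only at
  roots, because \<open>root_update\<close> ignores whatever is sent elsewhere.\<close>

definition message_update :: "(nat \<times> nat) set \<Rightarrow> (nat \<Rightarrow> nat) \<Rightarrow> (nat \<Rightarrow> nat) \<Rightarrow> bool" where
  "message_update M p q \<longleftrightarrow>
     (\<forall>v. (q v = p v \<or> (q v, v) \<in> M) \<and> q v \<le> p v \<and>
          (p v = v \<longrightarrow> (\<forall>a. (a, v) \<in> M \<longrightarrow> q v \<le> a)))"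

lemma message_updateD:
  assumes "message_update M p q"
  shows "q v = p v \<or> (q v, v) \<in> M" "q v \<le> p v"
    "p v = v \<Longrightarrow> (a, v) \<in> M \<Longrightarrow> q v \<le> a"
  using assms by (auto simp: message_update_def)

lemma finite_senders: "finite M \<Longrightarrow> finite {a. (a, v) \<in> M}"
  by (rule finite_subset[of _ "fst ` M"]) force+

lemma message_update_update:
  assumes "finite M"
  shows "message_update M (parent s) (parent (update M s))"
  unfolding message_update_def
proof
  fix v
  let ?A = "insert (parent s v) {a. (a, v) \<in> M}"
  have "finite ?A" using finite_senders[OF assms] by simp
  then have "Min ?A \<in> ?A" "\<And>a. a \<in> ?A \<Longrightarrow> Min ?A \<le> a"
    using Min_in Min_le by blast+
  then show "(parent (update M s) v = parent s v \<or> (parent (update M s) v, v) \<in> M) \<and>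
      parent (update M s) v \<le> parent s v \<and>
      (parent s v = v \<longrightarrow> (\<forall>a. (a, v) \<in> M \<longrightarrow> parent (update M s) v \<le> a))"
    unfolding update_def by (auto simp del: Min_le_iff Min_insert)
qed

lemma message_update_root_update:
  assumes "finite M"
  shows "message_update M (parent s) (parent (root_update M s))"
proof -
  have "parent (root_update M s) v =
      (if parent s v = v then parent (update M s) v else parent s v)" for v
    by (simp add: root_update_def update_def)
  then show ?thesis
    using message_update_update[OF assms, of s] by (auto simp: message_update_def)
qed

lemma sym_adjacency: "sym (adjacency s)"
  by (auto simp: sym_def adjacency_def)

lemma adjacency_rtrancl_sym: "(a, b) \<in> (adjacency s)\<^sup>* \<Longrightarrow> (b, a) \<in> (adjacency s)\<^sup>*"
  using sym_adjacency sym_rtrancl by (metis symD)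

lemma adjacency_vertices: "ugraph G \<Longrightarrow> (a, b) \<in> adjacency G \<Longrightarrow> a \<in> vertices G \<and> b \<in> vertices G"
  by (auto simp: adjacency_def ugraph_def)

lemma adjacency_alter:
  "adjacency (alter s) =
     {(parent s a, parent s b) | a b. (a, b) \<in> adjacency s \<and> parent s a \<noteq> parent s b}"
  by (fastforce simp: adjacency_def alter_def)

section \<open>A common form for the rounds of all five algorithms\<close>

fun messages :: "algorithm \<Rightarrow> 'e state \<Rightarrow> (nat \<times> nat) set" where
  "messages Alg_P s = parent_connect s"
| "messages Alg_E s = extended_connect s"
| "messages Alg_A s = connect s"
| "messages Alg_R s = parent_connect s"
| "messages Alg_RA s = connect s"

fun alters :: "algorithm \<Rightarrow> bool" where
  "alters Alg_A = True"
| "alters Alg_RA = True"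
| "alters _ = False"

lemma finite_messages:
  assumes "finite (edges s)"
  shows "finite (messages alg s)"
proof -
  have "connect s = (\<lambda>e. (min (end_v s e) (end_w s e), max (end_v s e) (end_w s e))) ` edges s"
    "parent_connect s = (\<lambda>e. let x = parent s (end_v s e); y = parent s (end_w s e)
       in (min x y, max x y)) ` edges s"
    by (auto simp: connect_def parent_connect_def Let_def)
  then have "finite (connect s)" "finite (parent_connect s)" using assms by simp_all
  moreover have "finite (extended_connect s)"
    using assms by (auto simp: extended_connect_def Let_def)
  ultimately show ?thesis by (cases alg) auto
qed

lemma connect_subset_adjacency: "connect s \<subseteq> adjacency s"
  by (auto simp: connect_def adjacency_def min_def max_def)

lemma adjacency_in_connect: "(a, b) \<in> adjacency s \<Longrightarrow> a < b \<Longrightarrow> (a, b) \<in> connect s"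
  by (force simp: connect_def adjacency_def min_def max_def)

lemma messages_alters: "alters alg \<Longrightarrow> messages alg s = connect s"
  by (cases alg) auto

text \<open>This is the one property of the connect step that P, E and R share and that correctness
  needs: at a fixed point it rules out edges whose ends have different roots.\<close>

lemma parent_message:
  assumes "\<not> alters alg" "(a, b) \<in> adjacency s" "parent s a < parent s b"
  shows "(parent s a, parent s b) \<in> messages alg s"
proof -
  obtain e where e: "e \<in> edges s"
    "(a, b) = (end_v s e, end_w s e) \<or> (a, b) = (end_w s e, end_v s e)"
    using assms(2) by (auto simp: adjacency_def)
  have "(parent s a, parent s b) =
      (min (parent s (end_v s e)) (parent s (end_w s e)),
       max (parent s (end_v s e)) (parent s (end_w s e)))"
    using e(2) assms(3) by auto
  then have "(parent s a, parent s b) \<in> parent_connect s"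
    unfolding parent_connect_def using e(1) by blast
  moreover have "(parent s a, parent s b) \<in> extended_connect s"
    unfolding extended_connect_def using e assms(3) by (intro UN_I[of e]) (auto simp: Let_def)
  ultimately show ?thesis using assms(1) by (cases alg) auto
qed

lemma message_connected:
  assumes "equiv UNIV r" and "adjacency s \<subseteq> r" and "\<And>v. (v, parent s v) \<in> r"
    and "(a, v) \<in> messages alg s"
  shows "(v, a) \<in> r"
proof -
  have s: "(x, y) \<in> r \<Longrightarrow> (y, x) \<in> r" and t: "(x, y) \<in> r \<Longrightarrow> (y, z) \<in> r \<Longrightarrow> (x, z) \<in> r" for x y z
    using assms(1) by (auto simp: equiv_def dest: symD transD)
  have e: "(end_v s e, end_w s e) \<in> r" if "e \<in> edges s" for e
    using assms(2) that by (auto simp: adjacency_def)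
  have p: "(parent s (end_v s e), end_w s e) \<in> r" "(parent s (end_w s e), end_v s e) \<in> r"
    "(parent s (end_v s e), parent s (end_w s e)) \<in> r"
    if "e \<in> edges s" for e
    using e[OF that] assms(3) s t by meson+
  \<comment> \<open>All three connect operations send only between ends and parents belonging to a
    single edge; the six pairs cover every case.\<close>
  have "\<exists>e\<in>edges s. (a, v) \<in>
      (let x = end_v s e; y = end_w s e; x' = parent s x; y' = parent s y
       in {(x, y), (y, x), (x', y'), (y', x'), (x', y), (y', x)})"
    using assms(4)
    by (cases alg)
      (auto simp: connect_def parent_connect_def extended_connect_def Let_def min_def max_def
        split: if_splits)
  then show ?thesis using e p s by (auto simp: Let_def)
qed

text \<open>Here \<open>q\<close> is the parent function between the update and the shortcut. From
  now on a round is described by \<open>q\<close> alone, and only the distinction made by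
  \<open>alters\<close> remains.\<close>

lemma round_message_update:
  assumes "finite (edges s)"
  shows "\<exists>q. message_update (messages alg s) (parent s) q \<and>
    parent (round alg s) = (\<lambda>v. q (q v)) \<and>
    adjacency (round alg s) = (if alters alg
      then {(q (q a), q (q b)) | a b. (a, b) \<in> adjacency s \<and> q (q a) \<noteq> q (q b)}
      else adjacency s)"
proof -
  define u where "u = (if alg \<in> {Alg_R, Alg_RA} then root_update (messages alg s) s
    else update (messages alg s) s)"
  have r: "round alg s = (if alters alg then alter (shortcut u) else shortcut u)"
    by (cases alg) (auto simp: u_def)
  have a: "adjacency u = adjacency s" "adjacency (shortcut u) = adjacency u"
    by (auto simp: u_def update_def root_update_def shortcut_def adjacency_def)
  have "message_update (messages alg s) (parent s) (parent u)"
    using message_update_update[OF finite_messages[OF assms]]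
      message_update_root_update[OF finite_messages[OF assms]]
    unfolding u_def by (cases "alg \<in> {Alg_R, Alg_RA}") (simp_all only: if_True if_False)
  moreover have "parent (round alg s) = (\<lambda>v. parent u (parent u v))"
    by (simp add: r alter_def shortcut_def)
  moreover have "adjacency (round alg s) =
      {(parent u (parent u a), parent u (parent u b)) | a b.
         (a, b) \<in> adjacency s \<and> parent u (parent u a) \<noteq> parent u (parent u b)}"
    if "alters alg"
    using that a by (simp add: r adjacency_alter) (simp add: shortcut_def)
  moreover have "adjacency (round alg s) = adjacency s" if "\<not> alters alg"
    using that a by (simp add: r)
  ultimately show ?thesis by (intro exI[of _ "parent u"]) simp
qed

lemma round_graph:
  shows "vcount (round alg s) = vcount s" "finite (edges s) \<Longrightarrow> finite (edges (round alg s))"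
  by (cases alg; simp add: alter_def shortcut_def update_def root_update_def)+

section \<open>Invariants\<close>

text \<open>The parent conditions range over all numbers: one that is not a vertex of a well-formed
  \<open>G\<close> is connected only to itself, so it has to stay its own parent.\<close>

definition sound_state :: "'e ugraph \<Rightarrow> 'e state \<Rightarrow> bool" where
  "sound_state G s \<longleftrightarrow> vcount s = vcount G \<and> finite (edges s) \<and>
     adjacency s \<subseteq> (adjacency G)\<^sup>* \<and>
     (\<forall>v. parent s v \<le> v \<and> (v, parent s v) \<in> (adjacency G)\<^sup>*)"

text \<open>
  The last conjunct says that current edges and parent pointers together connect all vertices that
  are adjacent in \<open>G\<close>; functions that are constant along them stand for their components.
\<close>

definition altered_state :: "'e ugraph \<Rightarrow> 'e state \<Rightarrow> bool" where
  "altered_state G s \<longleftrightarrow>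
     (\<forall>(a, b)\<in>adjacency s. a \<in> range (parent s) \<and> (a, parent s a) \<in> (adjacency s)\<^sup>*) \<and>
     (\<forall>f :: nat \<Rightarrow> nat. (\<forall>(a, b)\<in>adjacency s. f a = f b) \<longrightarrow> (\<forall>v. f (parent s v) = f v) \<longrightarrow>
        (\<forall>(a, b)\<in>adjacency G. f a = f b))"

definition loop_invariant :: "algorithm \<Rightarrow> 'e ugraph \<Rightarrow> 'e state \<Rightarrow> bool" where
  "loop_invariant alg G s \<longleftrightarrow> sound_state G s \<and>
     (if alters alg then altered_state G s else adjacency s = adjacency G)"

lemma loop_invariant_init: "ugraph G \<Longrightarrow> loop_invariant alg G (init G)"
  by (auto simp: loop_invariant_def sound_state_def altered_state_def init_def ugraph_def
      adjacency_def)

lemma equiv_component: "equiv UNIV ((adjacency G)\<^sup>*)"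
  by (simp add: equiv_def refl_rtrancl sym_rtrancl sym_adjacency trans_rtrancl)

lemma sound_state_round:
  assumes "sound_state G s"
  shows "sound_state G (round alg s)" and "parent (round alg s) v \<le> parent s v"
proof -
  let ?r = "(adjacency G)\<^sup>*"
  have s: "finite (edges s)" "adjacency s \<subseteq> ?r" "\<And>v. (v, parent s v) \<in> ?r" "\<And>v. parent s v \<le> v"
    using assms by (auto simp: sound_state_def)
  obtain q where q: "message_update (messages alg s) (parent s) q"
    and p: "parent (round alg s) = (\<lambda>v. q (q v))"
    and A: "adjacency (round alg s) = (if alters alg
      then {(q (q a), q (q b)) | a b. (a, b) \<in> adjacency s \<and> q (q a) \<noteq> q (q b)}
      else adjacency s)"
    using round_message_update[OF s(1)] by blast
  have "(v, q v) \<in> ?r" for v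
    using message_updateD(1)[OF q, of v] message_connected[OF equiv_component s(2,3)] s(3) by metis
  then have qq: "(v, q (q v)) \<in> ?r" for v by (meson rtrancl_trans)
  have le: "q v \<le> v" for v using message_updateD(2)[OF q, of v] s(4)[of v] by linarith
  show "parent (round alg s) v \<le> parent s v"
    using le[of "q v"] message_updateD(2)[OF q, of v] by (simp add: p)
  have "(q (q a), q (q b)) \<in> ?r" if "(a, b) \<in> adjacency s" for a b
    using that s(2) qq adjacency_rtrancl_sym by (meson rtrancl_trans subsetD)
  then have "adjacency (round alg s) \<subseteq> ?r"
    using s(2) by (auto simp: A)
  moreover have "q (q v) \<le> v" for v using le le_trans by blast
  ultimately show "sound_state G (round alg s)"
    using assms qq by (simp add: sound_state_def round_graph p)
qed

lemma altered_state_round: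
  assumes sound: "sound_state G s" and "altered_state G s" and "alters alg"
  shows "altered_state G (round alg s)"
proof -
  have s: "finite (edges s)" "\<And>v. parent s v \<le> v"
    using sound by (auto simp: sound_state_def)
  obtain q where q: "message_update (messages alg s) (parent s) q"
    and p: "parent (round alg s) = (\<lambda>v. q (q v))"
    and A: "adjacency (round alg s) =
           {(q (q a), q (q b)) | a b. (a, b) \<in> adjacency s \<and> q (q a) \<noteq> q (q b)}"
    using round_message_update[OF s(1), of alg] assms(3) by auto
  let ?r = "(adjacency s)\<^sup>*" and ?r' = "(adjacency (round alg s))\<^sup>*"
  have end_parent: "(v, parent s v) \<in> ?r" if "v \<in> Domain (adjacency s)" for v
    using assms(2) that by (auto simp: altered_state_def)
  have end_closed: "w \<in> Domain (adjacency s)" if "(v, w) \<in> ?r" "v \<in> Domain (adjacency s)" for v w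
    using that by (induction rule: rtrancl_induct) (auto dest: symD[OF sym_adjacency])
  \<comment> \<open>The messages of \<open>connect\<close> run along current edges, so a vertex that
    is not an end of an edge keeps its parent.\<close>
  have q_cases: "q v = parent s v \<or> (v, q v) \<in> adjacency s" for v
    using message_updateD(1)[OF q, of v] connect_subset_adjacency sym_adjacency[of s] assms(3)
    by (auto simp: messages_alters dest: symD)
  have end_q: "(v, q v) \<in> ?r" if "v \<in> Domain (adjacency s)" for v
    using q_cases[of v] end_parent[OF that] by auto
  have end_qq: "(v, q (q v)) \<in> ?r" if "v \<in> Domain (adjacency s)" for v
    using end_q[OF that] end_closed[OF end_q[OF that] that] end_q[of "q v"] by auto
  \<comment> \<open>The map sending \<open>v\<close> to \<open>q (q v)\<close> takes each old edge
    to a new edge or collapses it to a point.\<close>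
  have path: "(q (q a), q (q b)) \<in> ?r'" if "(a, b) \<in> ?r" for a b
    using that
  proof (induction rule: rtrancl_induct)
    case (step b c)
    then have "q (q b) = q (q c) \<or> (q (q b), q (q c)) \<in> adjacency (round alg s)"
      unfolding A by blast
    then show ?case using step.IH by auto
  qed simp
  \<comment> \<open>A new end is \<open>q (q a')\<close> for an old end \<open>a'\<close>. The image
    of the old path from \<open>a'\<close> to \<open>q (q a')\<close> is a new path from that end to
    its new parent.\<close>
  have "\<forall>(a, b)\<in>adjacency (round alg s). a \<in> range (parent (round alg s)) \<and>
      (a, parent (round alg s) a) \<in> ?r'"
  proof clarify
    fix a b assume "(a, b) \<in> adjacency (round alg s)"
    then obtain a' where "a' \<in> Domain (adjacency s)" "a = q (q a')" by (auto simp: A)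
    then show "a \<in> range (parent (round alg s)) \<and> (a, parent (round alg s) a) \<in> ?r'"
      using path[OF end_qq] by (auto simp: p)
  qed
  \<comment> \<open>It suffices that a function constant along the new edges and parents is also
    constant along the old ones.\<close>
  moreover have "\<forall>(a, b)\<in>adjacency G. f a = f b"
    if edge: "\<forall>(a, b)\<in>adjacency (round alg s). f a = f b"
      and link: "\<forall>v. f (parent (round alg s) v) = f v" for f :: "nat \<Rightarrow> nat"
  proof -
    have qq: "f (q (q v)) = f v" for v using link by (simp add: p)
    have old_edge: "f a = f b" if "(a, b) \<in> adjacency s" for a b
    proof -
      have "f (q (q a)) = f (q (q b))"
        using that edge by (cases "q (q a) = q (q b)") (auto simp: A)
      then show ?thesis by (simp add: qq)
    qed
    have old_path: "f a = f b" if "(a, b) \<in> ?r" for a b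
      using that by (induction rule: rtrancl_induct) (auto dest: old_edge)
    \<comment> \<open>The assumption on \<open>f\<close> concerns only \<open>q (q v)\<close>. An
      end reaches its old parent by old edges; for the other vertices, induction uses that the
      parent of a non-root is smaller.\<close>
    have old_link: "f (parent s v) = f v" for v
    proof (induction v rule: less_induct)
      case (less v)
      show ?case
      proof (cases "v \<in> Domain (adjacency s) \<or> parent s v = v")
        case True
        then show ?thesis using old_path[OF end_parent, of v] by metis
      next
        case False
        then have "q v = parent s v" using q_cases[of v] by auto
        moreover have "parent s v < v" using False s(2)[of v] by simp
        \<comment> \<open>With \<open>q v = parent s v\<close>, one more application of
          \<open>q\<close> follows either an old parent pointer, covered by induction, or an old
          edge.\<close>
        then have "f (q (parent s v)) = f (parent s v)"
          using less.IH q_cases[of "parent s v"] old_edge by metis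
        ultimately show ?thesis using qq[of v] by simp
      qed
    qed
    show ?thesis using assms(2) old_edge old_link unfolding altered_state_def by blast
  qed
  ultimately show ?thesis unfolding altered_state_def by blast
qed

lemma loop_invariant_round:
  assumes "loop_invariant alg G s"
  shows "loop_invariant alg G (round alg s)"
proof -
  have "finite (edges s)" using assms by (simp add: loop_invariant_def sound_state_def)
  then have "\<not> alters alg \<Longrightarrow> adjacency (round alg s) = adjacency s"
    using round_message_update[of s alg] by auto
  then show ?thesis
    using assms sound_state_round(1) altered_state_round by (auto simp: loop_invariant_def)
qed

section \<open>Termination and the final state\<close>

lemma component_outside:
  assumes "ugraph G" "(v, u) \<in> (adjacency G)\<^sup>*" "v \<notin> vertices G"
  shows "u = v"
  using assms(2,3) adjacency_vertices[OF assms(1)] by (metis converse_rtranclE)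

lemma component_closed:
  assumes "ugraph G" "(v, u) \<in> (adjacency G)\<^sup>*" "v \<in> vertices G"
  shows "u \<in> vertices G"
  using assms(2,3) adjacency_vertices[OF assms(1)] by (metis rtranclE)

lemma stops_in_exists:
  "loop_invariant alg G s \<Longrightarrow> \<exists>t. stops_in alg s t"
proof (induction "\<Sum>v\<in>vertices s. parent s v" arbitrary: s rule: less_induct)
  case less
  show ?case
  proof (cases "parent_unchanged s (round alg s)")
    case True
    then show ?thesis by (blast intro: stops_in.last)
  next
    case False
    have le: "parent (round alg s) v \<le> parent s v" for v
      using less.prems sound_state_round(2) by (auto simp: loop_invariant_def)
    have "vertices (round alg s) = vertices s" by (simp add: vertices_def round_graph)
    moreover have "\<exists>v\<in>vertices s. parent (round alg s) v < parent s v"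
      using False le unfolding parent_unchanged_def by (metis le_neq_implies_less)
    then have "(\<Sum>v\<in>vertices s. parent (round alg s) v) < (\<Sum>v\<in>vertices s. parent s v)"
      using le by (intro sum_strict_mono_ex1) (auto simp: vertices_def)
    ultimately have "\<exists>t. stops_in alg (round alg s) t"
      using less.hyps loop_invariant_round[OF less.prems] by simp
    then show ?thesis using False by (blast intro: stops_in.again)
  qed
qed

text \<open>Reduces correctness to a single round: the last one, which starts from a state
  \<open>r\<close> satisfying the invariant and changes no parent.\<close>

lemma stops_in_unchanged:
  "stops_in alg s t \<Longrightarrow> loop_invariant alg G s \<Longrightarrow>
     \<exists>r. loop_invariant alg G r \<and> t = round alg r \<and> parent_unchanged r t"
  by (induction rule: stops_in.induct) (use loop_invariant_round in blast)+

lemma unchanged_round_flat: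
  assumes "ugraph G" and inv: "loop_invariant alg G s" and "parent_unchanged s (round alg s)"
  shows "parent (round alg s) = parent s" and "parent s (parent s v) = parent s v"
    and "(a, b) \<in> adjacency G \<Longrightarrow> parent s a = parent s b"
proof -
  have sound: "sound_state G s" using inv by (simp add: loop_invariant_def)
  then have s: "finite (edges s)" "\<And>v. parent s v \<le> v" "vertices s = vertices G"
    by (auto simp: sound_state_def vertices_def)
  show eq: "parent (round alg s) = parent s"
  proof
    fix v
    show "parent (round alg s) v = parent s v"
    proof (cases "v \<in> vertices G")
      case True
      then show ?thesis using assms(3) s(3) by (simp add: parent_unchanged_def)
    next
      \<comment> \<open>The stopping test inspects vertices only; elsewhere both parents are the
        number itself.\<close>
      case False
      then show ?thesis
        using sound sound_state_round(1)[OF sound] component_outside[OF assms(1)]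
        unfolding sound_state_def by metis
    qed
  qed
  obtain q where q: "message_update (messages alg s) (parent s) q"
    and p: "parent (round alg s) = (\<lambda>v. q (q v))"
    using round_message_update[OF s(1)] by blast
  \<comment> \<open>Neither half of the round can undo the other:
    \<open>q (q v) \<le> q v \<le> parent s v\<close>, and the outer terms are equal.\<close>
  have qp: "q v = parent s v" for v
  proof -
    have "q (q v) \<le> q v" using message_updateD(2)[OF q, of "q v"] s(2)[of "q v"] by linarith
    moreover have "q (q v) = parent s v" using eq p by metis
    ultimately show ?thesis using message_updateD(2)[OF q, of v] by simp
  qed
  show flat: "parent s (parent s v) = parent s v" for v
    using eq p qp by metis
  have no_message: "a \<ge> v" if "(a, v) \<in> messages alg s" "parent s v = v" for a v
    using message_updateD(3)[OF q that(2,1)] that(2) by (simp add: qp)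
  show "parent s a = parent s b" if ab: "(a, b) \<in> adjacency G"
  proof (cases "alters alg")
    case True
    then have alt: "altered_state G s" using inv by (simp add: loop_invariant_def)
    \<comment> \<open>Every end is a value of \<open>parent s\<close>, hence a root by
      flatness.\<close>
    have root: "parent s x = x" if "(x, y) \<in> adjacency s" for x y
      using alt that flat by (auto simp: altered_state_def)
    have ge: "x \<ge> y" if "(x, y) \<in> adjacency s" for x y
    proof (rule ccontr)
      assume "\<not> x \<ge> y"
      moreover have "parent s y = y" using root symD[OF sym_adjacency that] by blast
      ultimately show False
        using no_message[of x y] adjacency_in_connect[OF that] True by (simp add: messages_alters)
    qed
    \<comment> \<open>By symmetry only loops can remain. So \<open>parent s\<close> is constant
      along edges and, by flatness, along parent pointers: it serves as the function
      \<open>f\<close> in \<open>altered_state\<close>.\<close>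
    have "\<forall>(x, y)\<in>adjacency s. parent s x = parent s y"
      using ge symD[OF sym_adjacency] by (metis (mono_tags, lifting) case_prodI2 order_antisym)
    then show ?thesis using alt ab flat unfolding altered_state_def by blast
  next
    case False
    then have adj: "adjacency s = adjacency G" using inv by (simp add: loop_invariant_def)
    \<comment> \<open>Otherwise \<open>parent s x\<close> would be sent to the larger
      \<open>parent s y\<close>, which is a root by flatness.\<close>
    have "parent s y \<le> parent s x" if "(x, y) \<in> adjacency s" for x y
      using no_message[of "parent s x" "parent s y"] parent_message[OF False that] flat[of y]
      by linarith
    then show ?thesis using ab symD[OF sym_adjacency ab] adj by (metis order_antisym)
  qed
qed

theorem theorem4:
  fixes G :: "'e ugraph" and alg :: algorithm
  assumes "ugraph G"
  shows "(\<exists>t. stops_in alg (init G) t) \<and>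
    (\<forall>t. stops_in alg (init G) t \<longrightarrow>
      (\<forall>v\<in>vertices G. parent t v \<in> component G v \<and> parent t (parent t v) = parent t v) \<and>
      (\<forall>u\<in>vertices G. \<forall>v\<in>vertices G.
         parent t u = parent t v \<longleftrightarrow> u \<in> component G v))"
proof (intro conjI allI impI)
  show "\<exists>t. stops_in alg (init G) t"
    using stops_in_exists loop_invariant_init[OF assms] by blast
next
  fix t assume "stops_in alg (init G) t"
  then obtain r where r: "loop_invariant alg G r" "t = round alg r" "parent_unchanged r t"
    using stops_in_unchanged loop_invariant_init[OF assms] by blast
  note flat = unchanged_round_flat[OF assms r(1) r(3)[unfolded r(2)]]
  \<comment> \<open>The flatness facts concern \<open>r\<close>, the state before the last round;
    they carry over to \<open>t\<close> because the parents coincide.\<close>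
  have pt: "parent t = parent r" using flat(1) r(2) by simp
  have reach: "(v, parent t v) \<in> (adjacency G)\<^sup>*" for v
    using r(1) by (simp add: pt loop_invariant_def sound_state_def)
  show "\<forall>v\<in>vertices G. parent t v \<in> component G v \<and> parent t (parent t v) = parent t v"
    using reach component_closed[OF assms] flat(2) by (auto simp: component_def pt)
  have same: "parent t u = parent t v" if "(v, u) \<in> (adjacency G)\<^sup>*" for u v
    using that by (induction rule: rtrancl_induct) (auto simp: pt dest: flat(3))
  have "(v, u) \<in> (adjacency G)\<^sup>*" if "parent t u = parent t v" for u v
    using reach[of v] adjacency_rtrancl_sym[OF reach[of u]] that by (metis rtrancl_trans)
  then show "\<forall>u\<in>vertices G. \<forall>v\<in>vertices G. parent t u = parent t v \<longleftrightarrow> u \<in> component G v"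
    using same unfolding component_def by blast
qed

end
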